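(* Let $N\ge1$, $1\le M\le T$ be integers, let $S_N=[s_{ij}]$ be an $N\times N$ row-stochastic matrix (the interaction matrix of a connected directed weighted network on $N$ nodes), and let $c_{1,M},c_{2,M}$ be real numbers with $c_{2,M}\in(-1/M,1/M)\setminus\{0\}$ and $\max(0,-c_{2,M}K)\le c_{1,M}\le\min(1,1-c_{2,M}K)$ for all $K\in\{0,1,\dots,M\}$. For every ordered pair $(j,i)\in\{1,\dots,N\}^2$ let $1\le k_{ji}^{(1)}<\cdots<k_{ji}^{(M)}\le T$ be integers. Consider the time-delayed recursion $$P_i(t)=c_{1,M}+c_{2,M}\sum_{j=1}^N s_{ij}\sum_{n\in\{k_{ji}^{(1)},\dots,k_{ji}^{(M)}\}}P_j(t-1-n),\qquad i\in\{1,\dots,N\}.$$ Then this recursion has a unique fixed point, it is stable, and it is given by $$P^{( * )}=(P_1^{( * )},\dots,P_N^{( * )})^{\mathbf T}=\frac{c_{1,M}}{1-c_{2,M}M}\,\mathbf 1_N .$$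
   Context: $\mathbf 1_N$ is the all-ones column vector of length $N$. Row-stochastic means nonnegative entries with each row summing to $1$. "Connected" for the directed network (edge from $j$ to $i$ iff $s_{ij}>0$) means that the underlying undirected graph is connected. Origin of the recursion: $N$ agents express binary opinions $Z_{i,t}\in\{0,1\}$; agent $i$ remembers at time $t>T$ the opinions of agent $j$ at the times in the memory set $\mathcal M_{ji}^{(t)}=\{t-k_{ji}^{(1)},\dots,t-k_{ji}^{(M)}\}$. The relative bias is $X_{ij,t}=c_{1,M}+c_{2,M}\sum_{n\in\mathcal M_{ji}^{(t)}}Z_{j,n}\in[0,1]$, and $Z_{i,t}=1$ with conditional probability $\sum_{j}s_{ij}X_{ij,t-1}$. The belief $P_i(t):=P(Z_{i,t}=1)$ then satisfies the displayed recursion. A fixed point of the recursion is a vector $P\in\mathbb R^N$ such that the constant sequence $P(t)=P$ satisfies the recursion. A fixed point is called stable if it is globally asymptotically stable: it is Lyapunov stable with respect to the initial history (the values of $P(\cdot)$ on the finitely many initial times needed to start the recursion), and for every initial history the solution $P(t)=(P_1(t),\dots,P_N(t))^{\mathbf T}$ converges to it as $t\to\infty$. *)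

theory Defs
  imports "HOL-Analysis.Analysis" "Graph_Theory.Graph_Theory"
begin

definition row_stochastic :: "real ^ 'n ^ 'n \<Rightarrow> bool" where
  "row_stochastic S \<longleftrightarrow>
     (\<forall>i j. 0 \<le> S $ i $ j) \<and> (\<forall>i. (\<Sum>j\<in>UNIV. S $ i $ j) = 1)"

definition interaction_network :: "real ^ 'n ^ 'n \<Rightarrow> ('n, 'n \<times> 'n) pre_digraph" where
  "interaction_network S =
     \<lparr>verts = UNIV, arcs = {(j, i). S $ i $ j > 0}, tail = fst, head = snd\<rparr>"

text \<open>
  \<open>k j i 1 < \<dots> < k j i M\<close> are the delays with which agent \<open>i\<close> remembers agent \<open>j\<close>; all of them
  lie in \<open>{1..T}\<close>.
\<close>

definition delay_system :: "nat \<Rightarrow> nat \<Rightarrow> ('n \<Rightarrow> 'n \<Rightarrow> nat \<Rightarrow> nat) \<Rightarrow> bool" where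
  "delay_system T M k \<longleftrightarrow>
     (\<forall>j i. strict_mono_on {1..M} (k j i) \<and> k j i ` {1..M} \<subseteq> {1..T})"

definition belief_update ::
  "real \<Rightarrow> real \<Rightarrow> real ^ 'n ^ 'n \<Rightarrow> nat \<Rightarrow> ('n \<Rightarrow> 'n \<Rightarrow> nat \<Rightarrow> nat)
    \<Rightarrow> (nat \<Rightarrow> real ^ 'n) \<Rightarrow> nat \<Rightarrow> real ^ 'n" where
  "belief_update c1 c2 S M k P t =
     (\<chi> i. c1 + c2 * (\<Sum>j\<in>UNIV. S $ i $ j * (\<Sum>n\<in>k j i ` {1..M}. P (t - 1 - n) $ j)))"

text \<open>
  The initial history consists of the values of \<open>P\<close> at the \<open>T + 1\<close> times \<open>0, \<dots>, T\<close>, which are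
  arbitrary; the recursion governs the times \<open>t > T\<close>. As all delays are at most \<open>T\<close>, the
  subtraction \<open>t - 1 - n\<close> on the natural numbers is never truncated there.
\<close>

definition solves_recursion ::
  "real \<Rightarrow> real \<Rightarrow> real ^ 'n ^ 'n \<Rightarrow> nat \<Rightarrow> nat \<Rightarrow> ('n \<Rightarrow> 'n \<Rightarrow> nat \<Rightarrow> nat)
    \<Rightarrow> (nat \<Rightarrow> real ^ 'n) \<Rightarrow> bool" where
  "solves_recursion c1 c2 S T M k P \<longleftrightarrow> (\<forall>t>T. P t = belief_update c1 c2 S M k P t)"

definition is_fixed_point ::
  "real \<Rightarrow> real \<Rightarrow> real ^ 'n ^ 'n \<Rightarrow> nat \<Rightarrow> nat \<Rightarrow> ('n \<Rightarrow> 'n \<Rightarrow> nat \<Rightarrow> nat)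
    \<Rightarrow> real ^ 'n \<Rightarrow> bool" where
  "is_fixed_point c1 c2 S T M k p \<longleftrightarrow> solves_recursion c1 c2 S T M k (\<lambda>t. p)"

definition lyapunov_stable ::
  "real \<Rightarrow> real \<Rightarrow> real ^ 'n ^ 'n \<Rightarrow> nat \<Rightarrow> nat \<Rightarrow> ('n \<Rightarrow> 'n \<Rightarrow> nat \<Rightarrow> nat)
    \<Rightarrow> real ^ 'n \<Rightarrow> bool" where
  "lyapunov_stable c1 c2 S T M k p \<longleftrightarrow>
     (\<forall>\<epsilon>>0. \<exists>\<delta>>0. \<forall>P. solves_recursion c1 c2 S T M k P \<longrightarrow>
        (\<forall>t\<le>T. dist (P t) p < \<delta>) \<longrightarrow> (\<forall>t. dist (P t) p < \<epsilon>))"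

definition globally_asymptotically_stable ::
  "real \<Rightarrow> real \<Rightarrow> real ^ 'n ^ 'n \<Rightarrow> nat \<Rightarrow> nat \<Rightarrow> ('n \<Rightarrow> 'n \<Rightarrow> nat \<Rightarrow> nat)
    \<Rightarrow> real ^ 'n \<Rightarrow> bool" where
  "globally_asymptotically_stable c1 c2 S T M k p \<longleftrightarrow>
     lyapunov_stable c1 c2 S T M k p \<and>
     (\<forall>P. solves_recursion c1 c2 S T M k P \<longrightarrow> P \<longlonglongrightarrow> p)"

end

theory Submission
  imports Defs
begin

text \<open>
  Put \<open>q = \<bar>c2\<bar> M < 1\<close> and let \<open>a\<close> be the common entry of the claimed fixed point. Since the rows of
  \<open>S\<close> sum to \<open>1\<close>, the deviation of any solution from \<open>a\<close> at time \<open>t\<close> is, in the maximum norm, at most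
  \<open>q\<close> times the largest deviation over the preceding \<open>T + 1\<close> times. Hence the deviation never exceeds
  its initial bound and shrinks by the factor \<open>q\<close> every \<open>T + 1\<close> steps. Uniqueness follows because a
  second fixed point would be a constant solution with another limit.
\<close>

lemma delay_system_card:
  assumes "delay_system T M k"
  shows "card (k j i ` {1..M}) = M"
  using assms unfolding delay_system_def
  by (simp add: card_image strict_mono_on_imp_inj_on)

lemma delay_system_mem:
  assumes "delay_system T M k" and "n \<in> k j i ` {1..M}"
  shows "1 \<le> n" and "n \<le> T"
proof -
  have "k j i ` {1..M} \<subseteq> {1..T}"
    using assms(1) unfolding delay_system_def by blast
  with assms(2) show "1 \<le> n" and "n \<le> T" by auto
qed

text \<open>Strict monotonicity makes the \<open>M\<close> delays distinct, so with row sum 1 the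
  subtracted \<open>a\<close> contributes exactly \<open>c2 * real M * a\<close>, and the scalar
  equation for \<open>a\<close> absorbs \<open>c1\<close>. What remains is linear in the
  deviations.\<close>

lemma belief_update_deviation:
  fixes S :: "real ^ 'n ^ 'n"
  assumes S: "row_stochastic S" and k: "delay_system T M k"
    and a: "c1 + c2 * real M * a = a"
  shows "belief_update c1 c2 S M k P t $ i - a =
    c2 * (\<Sum>j\<in>UNIV. S $ i $ j * (\<Sum>n\<in>k j i ` {1..M}. P (t - 1 - n) $ j - a))"
proof -
  have row: "(\<Sum>j\<in>UNIV. S $ i $ j) = 1"
    using S by (simp add: row_stochastic_def)
  have "(\<Sum>j\<in>UNIV. S $ i $ j * (\<Sum>n\<in>k j i ` {1..M}. P (t - 1 - n) $ j - a))
      = (\<Sum>j\<in>UNIV. S $ i $ j * (\<Sum>n\<in>k j i ` {1..M}. P (t - 1 - n) $ j))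
        - (\<Sum>j\<in>UNIV. S $ i $ j) * (real M * a)"
    by (simp only: sum_subtractf sum_constant delay_system_card[OF k] right_diff_distrib
        sum_distrib_right)
  then show ?thesis
    using a by (simp add: belief_update_def row right_diff_distrib mult.assoc del: One_nat_def)
qed

text \<open>Each inner sum has \<open>M\<close> terms of absolute value at most \<open>B\<close>;
  averaging over \<open>j\<close> with nonnegative weights of total 1 cannot enlarge the bound
  \<open>real M * B\<close>.\<close>

lemma belief_update_contraction:
  fixes S :: "real ^ 'n ^ 'n"
  assumes S: "row_stochastic S" and k: "delay_system T M k"
    and a: "c1 + c2 * real M * a = a"
    and B: "\<And>n j. \<lbrakk>1 \<le> n; n \<le> T\<rbrakk> \<Longrightarrow> \<bar>P (t - 1 - n) $ j - a\<bar> \<le> B"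
  shows "\<bar>belief_update c1 c2 S M k P t $ i - a\<bar> \<le> \<bar>c2\<bar> * real M * B"
proof -
  have row: "(\<Sum>j\<in>UNIV. S $ i $ j) = 1" and nonneg: "0 \<le> S $ i $ j" for j
    using S by (simp_all add: row_stochastic_def)
  have inner: "\<bar>\<Sum>n\<in>k j i ` {1..M}. P (t - 1 - n) $ j - a\<bar> \<le> real M * B" for j
  proof -
    have "\<bar>\<Sum>n\<in>k j i ` {1..M}. P (t - 1 - n) $ j - a\<bar>
        \<le> (\<Sum>n\<in>k j i ` {1..M}. \<bar>P (t - 1 - n) $ j - a\<bar>)"
      by (rule sum_abs)
    also have "\<dots> \<le> real (card (k j i ` {1..M})) * B"
      by (intro sum_bounded_above B delay_system_mem[OF k])
    finally show ?thesis
      by (simp only: delay_system_card[OF k])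
  qed
  have "\<bar>\<Sum>j\<in>UNIV. S $ i $ j * (\<Sum>n\<in>k j i ` {1..M}. P (t - 1 - n) $ j - a)\<bar>
      \<le> (\<Sum>j\<in>UNIV. \<bar>S $ i $ j * (\<Sum>n\<in>k j i ` {1..M}. P (t - 1 - n) $ j - a)\<bar>)"
    by (rule sum_abs)
  also have "\<dots> \<le> (\<Sum>j\<in>UNIV. S $ i $ j * (real M * B))"
    by (intro sum_mono) (simp only: abs_mult abs_of_nonneg nonneg inner mult_left_mono)
  also have "\<dots> = real M * B"
    by (simp only: sum_distrib_right[symmetric] row mult_1)
  finally show ?thesis
    unfolding belief_update_deviation[OF S k a] abs_mult mult.assoc
    by (intro mult_left_mono) simp_all
qed

text \<open>Here \<open>m\<close> counts blocks of length \<open>T + 1\<close>, the furthest an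
  update can look back. The case \<open>m = 0\<close> serves Lyapunov stability, growing
  \<open>m\<close> serves convergence.\<close>

lemma solution_decay:
  fixes S :: "real ^ 'n ^ 'n"
  assumes S: "row_stochastic S" and k: "delay_system T M k"
    and a: "c1 + c2 * real M * a = a"
    and q: "\<bar>c2\<bar> * real M \<le> 1"
    and P: "solves_recursion c1 c2 S T M k P"
    and B: "\<And>t j. t \<le> T \<Longrightarrow> \<bar>P t $ j - a\<bar> \<le> B"
  shows "m * (T + 1) \<le> t \<Longrightarrow> \<bar>P t $ i - a\<bar> \<le> (\<bar>c2\<bar> * real M) ^ m * B"
proof (induction m arbitrary: t i)
  case 0
  \<comment> \<open>Time 0 always belongs to the initial history, so \<open>B\<close> bounds some
    absolute value.\<close>
  have B0: "0 \<le> B"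
    using B[of 0] abs_ge_zero order_trans by blast
  \<comment> \<open>Strong induction on time, for all components at once because an update mixes
    them. After time \<open>T\<close> only earlier times are read, and a factor of at most 1
    preserves the bound.\<close>
  have "\<forall>i. \<bar>P t $ i - a\<bar> \<le> B" for t
  proof (induction t rule: less_induct)
    case (less t)
    show ?case
    proof (cases "t \<le> T")
      case False
      have step: "\<bar>P t $ i - a\<bar> \<le> \<bar>c2\<bar> * real M * B" for i
        using P False unfolding solves_recursion_def
        by (auto intro!: belief_update_contraction[OF S k a] less[rule_format])
      have "\<bar>c2\<bar> * real M * B \<le> 1 * B"
        using q B0 by (rule mult_right_mono)
      with step show ?thesis
        by (auto intro: order_trans)
    qed (use B in blast)
  qed
  then show ?case by simp
next
  case (Suc m)
  then have "T < t" by simp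
  \<comment> \<open>The times read are at least \<open>t - (T + 1)\<close>, hence at least
    \<open>m * (T + 1)\<close>.\<close>
  have "\<bar>P (t - 1 - n) $ j - a\<bar> \<le> (\<bar>c2\<bar> * real M) ^ m * B" if "n \<le> T" for n j
    using Suc.prems that by (intro Suc.IH) simp
  then have "\<bar>belief_update c1 c2 S M k P t $ i - a\<bar>
      \<le> \<bar>c2\<bar> * real M * ((\<bar>c2\<bar> * real M) ^ m * B)"
    by (intro belief_update_contraction[OF S k a])
  then show ?case
    using P \<open>T < t\<close> by (simp add: solves_recursion_def mult.assoc)
qed

lemma solution_tendsto:
  fixes S :: "real ^ 'n ^ 'n"
  assumes S: "row_stochastic S" and k: "delay_system T M k"
    and a: "c1 + c2 * real M * a = a"
    and q: "\<bar>c2\<bar> * real M < 1"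
    and P: "solves_recursion c1 c2 S T M k P"
  shows "P \<longlonglongrightarrow> a *\<^sub>R 1"
proof (rule vec_tendstoI)
  fix i
  \<comment> \<open>The history is arbitrary but has finitely many entries, so a maximal deviation
    exists.\<close>
  define B where "B = Max ((\<lambda>(t, j). \<bar>P t $ j - a\<bar>) ` ({..T} \<times> UNIV))"
  have B: "\<bar>P t $ j - a\<bar> \<le> B" if "t \<le> T" for t j
    unfolding B_def using that by (intro Max_ge) auto
  have "(\<lambda>m. (\<bar>c2\<bar> * real M) ^ m * B) \<longlonglongrightarrow> 0"
    using q by (intro tendsto_mult_left_zero LIMSEQ_power_zero) simp
  \<comment> \<open>The number of complete blocks before time \<open>t\<close> serves as the
    exponent \<open>m\<close>.\<close>
  moreover have "filterlim (\<lambda>t. t div (T + 1)) sequentially sequentially"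
    by (rule filterlim_at_top_div_const_nat) simp
  ultimately have "(\<lambda>t. (\<bar>c2\<bar> * real M) ^ (t div (T + 1)) * B) \<longlonglongrightarrow> 0"
    by (rule filterlim_compose)
  moreover have "\<bar>P t $ i - a\<bar> \<le> (\<bar>c2\<bar> * real M) ^ (t div (T + 1)) * B" for t
    by (rule solution_decay[OF S k a less_imp_le[OF q] P B div_times_less_eq_dividend])
  ultimately have "(\<lambda>t. P t $ i - a) \<longlonglongrightarrow> 0"
    by (intro Lim_null_comparison[where f = "\<lambda>t. P t $ i - a"]) auto
  then show "(\<lambda>t. P t $ i) \<longlonglongrightarrow> (a *\<^sub>R 1 :: real ^ 'n) $ i"
    by (simp add: LIM_zero_iff)
qed

lemma constant_lyapunov_stable:
  fixes S :: "real ^ 'n ^ 'n"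
  assumes S: "row_stochastic S" and k: "delay_system T M k"
    and a: "c1 + c2 * real M * a = a"
    and q: "\<bar>c2\<bar> * real M \<le> 1"
  shows "lyapunov_stable c1 c2 S T M k (a *\<^sub>R 1)"
  unfolding lyapunov_stable_def
proof (intro allI impI)
  fix \<epsilon> :: real
  assume "0 < \<epsilon>"
  \<comment> \<open>Bounding the Euclidean norm by the l1 norm costs a factor
    \<open>CARD('n)\<close>; the 2 leaves \<open>\<epsilon> / 2\<close>, so the final inequality is
    strict.\<close>
  define \<delta> where "\<delta> = \<epsilon> / (2 * real CARD('n))"
  have "0 < \<delta>"
    using \<open>0 < \<epsilon>\<close> by (simp add: \<delta>_def)
  have "dist (P t) (a *\<^sub>R 1) < \<epsilon>"
    if P: "solves_recursion c1 c2 S T M k P"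
      and init: "\<forall>t\<le>T. dist (P t) (a *\<^sub>R 1) < \<delta>" for P t
  proof -
    have "\<bar>P t $ j - a\<bar> \<le> \<delta>" if "t \<le> T" for t j
      using init that component_le_norm_cart[of "P t - a *\<^sub>R 1" j]
      by (force simp: dist_norm)
    \<comment> \<open>With \<open>m = 0\<close> the decay bound holds at every time and has factor
      1.\<close>
    then have "\<bar>P t $ i - a\<bar> \<le> \<delta>" for i
      using solution_decay[OF S k a q P, of \<delta> 0] by simp
    then have "(\<Sum>i\<in>UNIV. \<bar>(P t - a *\<^sub>R 1) $ i\<bar>) \<le> real CARD('n) * \<delta>"
      by (intro sum_bounded_above) simp
    then have "dist (P t) (a *\<^sub>R 1) \<le> real CARD('n) * \<delta>"
      using norm_le_l1_cart[of "P t - a *\<^sub>R 1"] by (simp add: dist_norm)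
    also have "\<dots> < \<epsilon>"
      using \<open>0 < \<epsilon>\<close> by (simp add: \<delta>_def)
    finally show ?thesis .
  qed
  with \<open>0 < \<delta>\<close> show "\<exists>\<delta>>0. \<forall>P. solves_recursion c1 c2 S T M k P \<longrightarrow>
      (\<forall>t\<le>T. dist (P t) (a *\<^sub>R 1) < \<delta>) \<longrightarrow> (\<forall>t. dist (P t) (a *\<^sub>R 1) < \<epsilon>)"
    by blast
qed

lemma constant_is_fixed_point:
  fixes S :: "real ^ 'n ^ 'n"
  assumes "row_stochastic S" and "delay_system T M k" and "c1 + c2 * real M * a = a"
  shows "is_fixed_point c1 c2 S T M k (a *\<^sub>R 1)"
proof -
  have "belief_update c1 c2 S M k (\<lambda>t. a *\<^sub>R 1) t $ i - a = 0" for t i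
    unfolding belief_update_deviation[OF assms] by simp
  then show ?thesis
    by (simp add: is_fixed_point_def solves_recursion_def vec_eq_iff)
qed

theorem theorem1:
  fixes S :: "real ^ 'n ^ 'n"
    and c1 c2 :: real
    and M T :: nat
    and k :: "'n \<Rightarrow> 'n \<Rightarrow> nat \<Rightarrow> nat"
  assumes "1 \<le> M" and "M \<le> T"
    and "row_stochastic S"
    and "Digraph_Component.connected (interaction_network S)"
    and "c2 \<in> {- 1 / real M <..< 1 / real M} - {0}"
    and "\<forall>K\<in>{0..M}. max 0 (- c2 * real K) \<le> c1 \<and> c1 \<le> min 1 (1 - c2 * real K)"
    and "delay_system T M k"
  shows "(\<exists>!p. is_fixed_point c1 c2 S T M k p)
       \<and> is_fixed_point c1 c2 S T M k ((c1 / (1 - c2 * real M)) *\<^sub>R 1)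
       \<and> globally_asymptotically_stable c1 c2 S T M k ((c1 / (1 - c2 * real M)) *\<^sub>R 1)"
proof -
  define a where "a = c1 / (1 - c2 * real M)"
  have q: "\<bar>c2\<bar> * real M < 1"
    using assms(1,5) by (auto simp: abs_if field_simps)
  \<comment> \<open>The denominator of \<open>a\<close> must not vanish, since division by zero
    would give 0 and the scalar equation could fail.\<close>
  then have "c2 * real M \<noteq> 1"
    using abs_ge_self[of "c2 * real M"] by (simp add: abs_mult)
  then have a: "c1 + c2 * real M * a = a"
    by (simp add: a_def field_simps)
  note system = assms(3,7) a
  have fp: "is_fixed_point c1 c2 S T M k (a *\<^sub>R 1)"
    by (rule constant_is_fixed_point[OF system])
  moreover have "p = a *\<^sub>R 1" if "is_fixed_point c1 c2 S T M k p" for p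
    using solution_tendsto[OF system q, of "\<lambda>_. p"] that
    by (simp add: is_fixed_point_def LIMSEQ_const_iff)
  moreover have "globally_asymptotically_stable c1 c2 S T M k (a *\<^sub>R 1)"
    unfolding globally_asymptotically_stable_def
    using constant_lyapunov_stable[OF system less_imp_le[OF q]] solution_tendsto[OF system q]
    by blast
  ultimately show ?thesis
    unfolding a_def by blast
qed

end
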